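(* Let $m<n<\omega$ and let $X$ be a set with $|X|\geq\aleph_{n-1}$. Then $$\eta(\sigma_m(2^X),\sigma_n(2^X)) = \|T_X\| = \sum_{k=0}^m \binom{n}{k}\binom{n-k-1}{m-k},$$ where $T_X:C(\sigma_m(2^X))\to C(\sigma_n(2^X))$ is the canonical extension operator defined in the context.
   Context: For a set $X$ and a natural number $n$, $\sigma_n(2^X)=\{\chi_A\in\{0,1\}^X : A\subset X,\ |A|\le n\}$, where $\chi_A$ is the characteristic function of $A$, with the topology inherited from the product space $\{0,1\}^X$; it is compact, and $\sigma_m(2^X)\subset\sigma_n(2^X)$ is closed for $m<n$. For a compact Hausdorff space $K$, $C(K)$ is the Banach space of continuous real-valued functions on $K$ with the supremum norm. If $L\subset K$ is a closed subspace, a bounded linear operator $T:C(L)\to C(K)$ is an extension operator if $(Tf)|_L=f$ for every $f\in C(L)$. Put $\eta(L,K)=\inf\{\|T\| : T:C(L)\to C(K)\text{ is an extension operator}\}$, with $\eta(L,K)=\infty$ if there is no extension operator. With $[A]^{\le m}=\{B\subset A:|B|\le m\}$, the operator $T_X:C(\sigma_m(2^X))\to C(\sigma_n(2^X))$ is given by $$T_X(f)(\chi_A)=\sum_{B\in[A]^{\le m}}(-1)^{m-|B|}\binom{|A|-|B|-1}{m-|B|}f(\chi_B)\quad\text{if }m<|A|\le n,$$ and $T_X(f)(\chi_A)=f(\chi_A)$ if $|A|\le m$. *)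

theory Defs
  imports "HOL-Analysis.Analysis"
begin

unbundle cardinal_syntax

text \<open>\<open>has_aleph k A\<close> says that the cardinality of \<open>A\<close> is the \<open>k\<close>-th aleph. All sets live in the
  same type, which loses nothing: a set of cardinality aleph \<open>(k + 1)\<close> has a subset of
  cardinality aleph \<open>k\<close>.\<close>

primrec has_aleph :: "nat \<Rightarrow> 'a set \<Rightarrow> bool" where
  "has_aleph 0 A \<longleftrightarrow> |A| =o natLeq"
| "has_aleph (Suc k) A \<longleftrightarrow> (\<exists>B :: 'a set. has_aleph k B \<and> |A| =o cardSuc |B| )"

text \<open>Points of \<open>{0,1}\<^sup>X\<close> are functions that are \<open>undefined\<close> outside \<open>X\<close>, as required by
  \<^const>\<open>product_topology\<close>.\<close>

definition chi :: "'a set \<Rightarrow> 'a set \<Rightarrow> 'a \<Rightarrow> nat" where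
  "chi X A = restrict (indicator A) X"

definition sigma_set :: "nat \<Rightarrow> 'a set \<Rightarrow> ('a \<Rightarrow> nat) set" where
  "sigma_set n X = {chi X A | A. A \<subseteq> X \<and> finite A \<and> card A \<le> n}"

definition sigma_top :: "nat \<Rightarrow> 'a set \<Rightarrow> ('a \<Rightarrow> nat) topology" where
  "sigma_top n X =
     subtopology (product_topology (\<lambda>_. discrete_topology {0, 1}) X) (sigma_set n X)"

text \<open>Elements of \<open>C(K)\<close> are likewise \<open>undefined\<close> outside the carrier of \<open>K\<close>, so that equality of
  elements of \<open>C(K)\<close> is equality of functions. Norms take values in \<^typ>\<open>ennreal\<close>,
  so that no supremum or infimum below is ill-defined.\<close>

definition cont_fun :: "'b topology \<Rightarrow> ('b \<Rightarrow> real) set" where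
  "cont_fun K = {f \<in> extensional (topspace K). continuous_map K euclideanreal f}"

definition sup_norm :: "'b topology \<Rightarrow> ('b \<Rightarrow> real) \<Rightarrow> ennreal" where
  "sup_norm K f = (SUP x\<in>topspace K. ennreal \<bar>f x\<bar>)"

definition bounded_linear_op ::
    "'b topology \<Rightarrow> 'c topology \<Rightarrow> (('b \<Rightarrow> real) \<Rightarrow> 'c \<Rightarrow> real) \<Rightarrow> bool" where
  "bounded_linear_op L K T \<longleftrightarrow>
     (\<forall>f\<in>cont_fun L. T f \<in> cont_fun K) \<and>
     (\<forall>f\<in>cont_fun L. \<forall>g\<in>cont_fun L.
        T (\<lambda>x\<in>topspace L. f x + g x) = (\<lambda>y\<in>topspace K. T f y + T g y)) \<and>
     (\<forall>c. \<forall>f\<in>cont_fun L. T (\<lambda>x\<in>topspace L. c * f x) = (\<lambda>y\<in>topspace K. c * T f y)) \<and>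
     (\<exists>C::real. \<forall>f\<in>cont_fun L. sup_norm K (T f) \<le> ennreal C * sup_norm L f)"

definition op_norm ::
    "'b topology \<Rightarrow> 'c topology \<Rightarrow> (('b \<Rightarrow> real) \<Rightarrow> 'c \<Rightarrow> real) \<Rightarrow> ennreal" where
  "op_norm L K T = (SUP f\<in>{f \<in> cont_fun L. sup_norm L f \<le> 1}. sup_norm K (T f))"

definition extension_operator ::
    "'b set \<Rightarrow> 'b topology \<Rightarrow> (('b \<Rightarrow> real) \<Rightarrow> 'b \<Rightarrow> real) \<Rightarrow> bool" where
  "extension_operator L K T \<longleftrightarrow>
     bounded_linear_op (subtopology K L) K T \<and>
     (\<forall>f\<in>cont_fun (subtopology K L). restrict (T f) L = f)"

text \<open>Meant for \<open>L\<close> closed in \<open>K\<close>. In \<^typ>\<open>ennreal\<close> the infimum of the empty set is \<open>\<infinity>\<close>.\<close>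

definition eta :: "'b set \<Rightarrow> 'b topology \<Rightarrow> ennreal" where
  "eta L K = (INF T\<in>{T. extension_operator L K T}. op_norm (subtopology K L) K T)"

text \<open>A point \<open>a\<close> of \<open>sigma_set n X\<close> is \<open>chi X A\<close> for \<open>A = {x \<in> X. a x = 1}\<close>. The natural number
  subtractions do not truncate.\<close>

definition canonical_ext ::
    "nat \<Rightarrow> nat \<Rightarrow> 'a set \<Rightarrow> (('a \<Rightarrow> nat) \<Rightarrow> real) \<Rightarrow> ('a \<Rightarrow> nat) \<Rightarrow> real" where
  "canonical_ext m n X f = (\<lambda>a\<in>sigma_set n X.
     let A = {x \<in> X. a x = 1} in
     if card A \<le> m then f a
     else \<Sum>B\<in>{B. B \<subseteq> A \<and> card B \<le> m}.
       (-1) ^ (m - card B) * real ((card A - card B - 1) choose (m - card B)) * f (chi X B))"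

end

theory Submission
  imports Defs
begin

text \<open>
  Identify a point of \<open>\<sigma>\<^sub>n(2\<^sup>X)\<close> with a set \<open>A \<subseteq> X\<close> of at most \<open>n\<close> elements. A function \<open>f\<close> on
  \<open>\<sigma>\<^sub>m(2\<^sup>X)\<close> has a Moebius transform \<open>f\<^sup>*(C) = (\<Sum>B\<subseteq>C. (-1)\<^bsup>|C| + |B|\<^esup> f(B))\<close>, and the canonical
  extension is Moebius inversion truncated at level \<open>m\<close>: \<open>(T\<^sub>X f)(A)\<close> is the sum of \<open>f\<^sup>*(C)\<close> over
  all \<open>C \<subseteq> A\<close> with \<open>|C| \<le> m\<close> (\<open>canonical_ext_eq_sum_moebius\<close>). That \<open>T\<^sub>X f\<close> extends \<open>f\<close> is then
  Moebius inversion, and \<open>T\<^sub>X f\<close> is continuous because \<open>f\<^sup>*(C)\<close> is small as soon as \<open>C\<close> contains a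
  point far out: the values of \<open>f\<close> that enter then cancel almost in pairs
  (\<open>canonical_ext_continuous\<close>). The bound on the norm is the sum of the absolute values of the
  binomial coefficients, which grows with \<open>|A|\<close> (\<open>canonical_ext_bound\<close>).

  For the lower bound, let \<open>T\<close> be any extension operator and let \<open>f\<^sub>C\<close> be the continuous function
  with \<open>f\<^sub>C(S) = 1\<close> if \<open>C \<subseteq> S\<close> and \<open>f\<^sub>C(S) = 0\<close> otherwise. For fixed \<open>D\<close>, continuity makes the
  values of \<open>T f\<^sub>C\<close> at \<open>D \<union> {x}\<close> and at \<open>D\<close> close to each other for all \<open>x\<close> outside a finite set
  depending on \<open>D\<close>. As \<open>X\<close> has cardinality at least \<open>\<aleph>\<^bsub>n - 1\<^esub>\<close>, Kuratowski's free set theorem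
  (\<open>Kuratowski_free_set\<close>) yields an \<open>A\<close> with \<open>n\<close> elements all of whose elements \<open>x\<close> avoid the
  exceptional sets of all \<open>D \<subseteq> A - {x}\<close>. Building \<open>A\<close> up from \<open>C\<close> one point at a time then gives
  \<open>(T f\<^sub>C)(A) \<approx> f\<^sub>C(C) = 1\<close> for every \<open>C \<subseteq> A\<close> with \<open>|C| \<le> m\<close>. The function
  \<open>g(S) = (-1)\<^bsup>m + |S \<inter> A|\<^esup>\<close> has norm at most 1 and is the combination of the \<open>f\<^sub>C\<close> with
  coefficients \<open>(-1)\<^bsup>m\<^esup> (-2)\<^bsup>|C|\<^esup>\<close>, so \<open>(T g)(A)\<close> is close to the sum of these coefficients, and
  that sum is exactly the claimed norm (\<open>ext_const_eq_sum_neg2\<close>).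
\<close>

section \<open>Free sets for finite-set-valued maps\<close>

lemma card_of_Fpow_ordLeq_infinite:
  assumes "infinite Y"
  shows "|Fpow Y| \<le>o |Y|"
proof -
  define lev where "lev k = {E. E \<subseteq> Y \<and> finite E \<and> card E = k}" for k
  have lev: "|lev k| \<le>o |Y|" for k
  proof (induction k)
    case 0
    have "lev 0 = {{}}"
      by (auto simp: lev_def)
    then show ?case
      using assms by (metis card_of_singl_ordLeq finite.emptyI)
  next
    case (Suc k)
    have sub: "lev (Suc k) \<subseteq> (\<lambda>(y, E). insert y E) ` (Y \<times> lev k)"
    proof
      fix E assume E: "E \<in> lev (Suc k)"
      then obtain y E' where "E = insert y E'" "y \<notin> E'" "card E' = k" "finite E'"
        by (auto simp: lev_def card_Suc_eq)
      then show "E \<in> (\<lambda>(y, E). insert y E) ` (Y \<times> lev k)"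
        using E by (auto simp: lev_def)
    qed
    have "|Y \<times> lev k| \<le>o |Y|"
      using assms Suc.IH
      by (intro card_of_Times_ordLeq_infinite_Field)
         (simp_all add: Field_card_of card_of_card_order_on card_of_mono1)
    then show ?case
      by (rule ordLeq_transitive[OF card_of_mono1[OF sub] ordLeq_transitive[OF card_of_image]])
  qed
  have "Fpow Y = (\<Union>k\<in>UNIV. lev k)"
    by (auto simp: Fpow_def lev_def)
  moreover have "|UNIV :: nat set| \<le>o |Y|"
    using assms infinite_iff_card_of_nat by blast
  ultimately show ?thesis
    using card_of_UNION_ordLeq_infinite[OF assms, of UNIV lev] lev by simp
qed

text \<open>Adding all values of \<open>F\<close> on finite subsets, \<open>\<omega>\<close> times, does not increase an infinite
  cardinality, and every finite subset of the union already appears at a finite stage.\<close>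

lemma closure_under_finitary_map:
  fixes F :: "'a set \<Rightarrow> 'a set"
  assumes "infinite Y" "Y \<subseteq> X" and fin: "\<And>E. finite E \<Longrightarrow> E \<subseteq> X \<Longrightarrow> finite (F E)"
  obtains Z where "Y \<subseteq> Z" "Z \<subseteq> X" "|Z| \<le>o |Y|"
    "\<And>E. finite E \<Longrightarrow> E \<subseteq> Z \<Longrightarrow> F E \<inter> X \<subseteq> Z"
proof -
  \<comment> \<open>Intersecting with \<open>X\<close> keeps the closure inside \<open>X\<close>, whatever the values of \<open>F\<close> are.\<close>
  define step where "step = (\<lambda>W. W \<union> (\<Union>E\<in>Fpow W. F E \<inter> X))"
  define W where "W k = (step ^^ k) Y" for k
  have W_Suc: "W (Suc k) = step (W k)" for k
    by (simp add: W_def)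
  have W: "Y \<subseteq> W k \<and> W k \<subseteq> X \<and> |W k| \<le>o |Y|" for k
  proof (induction k)
    case 0
    then show ?case
      using assms by (auto simp: W_def intro: card_of_mono1)
  next
    case (Suc k)
    then have inf: "infinite (W k)"
      using assms finite_subset by blast
    have "|F E \<inter> X| \<le>o |Y|" if "E \<in> Fpow (W k)" for E
    proof -
      have "finite (F E \<inter> X)"
        using that fin Suc by (auto simp: Fpow_def)
      then show ?thesis
        using assms(1) by (rule ordLeq3_finite_infinite)
    qed
    moreover have "|Fpow (W k)| \<le>o |Y|"
      using card_of_Fpow_ordLeq_infinite[OF inf] Suc ordLeq_transitive by blast
    ultimately have "|\<Union>E\<in>Fpow (W k). F E \<inter> X| \<le>o |Y|"
      using card_of_UNION_ordLeq_infinite[OF assms(1), of "Fpow (W k)" "\<lambda>E. F E \<inter> X"]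
      by blast
    then have "|W (Suc k)| \<le>o |Y|"
      unfolding W_Suc step_def using Suc assms(1)
      by (intro card_of_Un_ordLeq_infinite_Field) (auto simp: Field_card_of card_of_card_order_on)
    then show ?case
      using Suc by (auto simp: W_Suc step_def)
  qed
  have mono: "mono W"
    by (rule monoI, rule lift_Suc_mono_le) (auto simp: W_Suc step_def)
  show thesis
  proof (rule that[of "\<Union>k. W k"])
    show "Y \<subseteq> (\<Union>k. W k)" "(\<Union>k. W k) \<subseteq> X"
      using W by blast+
    have "|UNIV :: nat set| \<le>o |Y|"
      using assms infinite_iff_card_of_nat by blast
    then show "|\<Union>k. W k| \<le>o |Y|"
      using card_of_UNION_ordLeq_infinite[OF assms(1)] W by blast
    show "F E \<inter> X \<subseteq> (\<Union>k. W k)" if E: "finite E" "E \<subseteq> (\<Union>k. W k)" for E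
    proof -
      have "\<exists>k. E \<subseteq> W k"
        using E
      proof (induction E)
        case (insert x E)
        then obtain k l where "E \<subseteq> W k" "x \<in> W l"
          by auto
        then have "insert x E \<subseteq> W (max k l)"
          using monoD[OF mono, of k "max k l"] monoD[OF mono, of l "max k l"] by auto
        then show ?case ..
      qed auto
      then obtain k where "E \<subseteq> W k" ..
      then have "F E \<inter> X \<subseteq> W (Suc k)"
        using E by (auto simp: W_Suc step_def Fpow_def)
      then show ?thesis
        by blast
    qed
  qed
qed

lemma has_aleph_infinite:
  "has_aleph k A \<Longrightarrow> infinite A"
proof (induction k arbitrary: A)
  case 0
  then show ?case
    using card_of_nat ordIso_imp_ordLeq ordIso_symmetric ordIso_transitive
      infinite_iff_card_of_nat by (metis has_aleph.simps(1))
next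
  case (Suc k)
  then obtain C :: "'a set" where C: "has_aleph k C" "|A| =o cardSuc |C|"
    by auto
  then have "|C| \<le>o |A|"
    using cardSuc_ordLeq[OF card_of_Card_order, of C] ordIso_symmetric ordLeq_ordIso_trans
    by blast
  then show ?case
    using Suc.IH[OF C(1)] card_of_ordLeq_infinite by blast
qed

text \<open>Induction on \<open>k\<close>. A subset \<open>Z\<close> of \<open>X\<close> of smaller cardinality that is closed under \<open>F\<close> leaves
  room for a point \<open>z\<close> outside. Inside \<open>Z\<close> the induction hypothesis gives a set \<open>A\<close> that is free for
  \<open>E \<mapsto> F (E \<union> {z})\<close>; since \<open>F A\<close> meets \<open>X\<close> only inside \<open>Z\<close>, the set \<open>A \<union> {z}\<close> is free for \<open>F\<close>.\<close>

theorem Kuratowski_free_set: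
  fixes F :: "'a set \<Rightarrow> 'a set" and K X :: "'a set"
  assumes "has_aleph k K" "|K| \<le>o |X|" "\<And>E. finite E \<Longrightarrow> E \<subseteq> X \<Longrightarrow> finite (F E)"
  obtains A where "A \<subseteq> X" "finite A" "card A = Suc k" "\<And>x. x \<in> A \<Longrightarrow> x \<notin> F (A - {x})"
proof -
  have "\<exists>A. A \<subseteq> X \<and> finite A \<and> card A = Suc k \<and> (\<forall>x\<in>A. x \<notin> F (A - {x}))"
    using assms
  proof (induction k arbitrary: K X F)
    case 0
    have "infinite X"
      using has_aleph_infinite[OF 0(1)] card_of_ordLeq_infinite[OF 0(2)] by blast
    moreover have "finite (F {})"
      using 0 by simp
    ultimately obtain x where "x \<in> X" "x \<notin> F {}"
      by (meson finite_subset subsetI)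
    then show ?case
      by (intro exI[of _ "{x}"]) auto
  next
    case (Suc k)
    from Suc.prems(1) obtain B :: "'a set" where B: "has_aleph k B" "|K| =o cardSuc |B|"
      by auto
    have less: "|B| <o |X|"
      using B(2) Suc.prems(2) cardSuc_greater[OF card_of_Card_order, of B]
        ordIso_symmetric ordLess_ordIso_trans ordLess_ordLeq_trans by blast
    have "infinite B"
      using B(1) by (rule has_aleph_infinite)
    obtain Y where Y: "Y \<subseteq> X" "|B| =o |Y|"
      using less internalize_card_of_ordLeq2[of B X] ordLess_imp_ordLeq by blast
    have "infinite Y"
      using \<open>infinite B\<close> Y(2) card_of_ordIso_finite by blast
    then obtain Z where Z: "Y \<subseteq> Z" "Z \<subseteq> X" "|Z| \<le>o |Y|"
      "\<And>E. finite E \<Longrightarrow> E \<subseteq> Z \<Longrightarrow> F E \<inter> X \<subseteq> Z"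
      using closure_under_finitary_map[of Y X F] Y(1) Suc.prems(3) by blast
    have "|Z| <o |X|"
      using Z(3) Y(2) less ordIso_symmetric ordLeq_ordIso_trans ordLeq_ordLess_trans by blast
    then have "\<not> X \<subseteq> Z"
      using card_of_mono1 not_ordLess_ordLeq by blast
    then obtain z where z: "z \<in> X" "z \<notin> Z"
      by blast
    have "|B| \<le>o |Z|"
      using Y(2) card_of_mono1[OF Z(1)] ordIso_ordLeq_trans by blast
    moreover have "finite (F (insert z E))" if "finite E" "E \<subseteq> Z" for E
      using that z Z(2) by (intro Suc.prems(3)) auto
    ultimately obtain A where A: "A \<subseteq> Z" "finite A" "card A = Suc k"
      "\<And>x. x \<in> A \<Longrightarrow> x \<notin> F (insert z (A - {x}))"
      using Suc.IH[OF B(1), of Z "\<lambda>E. F (insert z E)"] by blast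
    have "z \<notin> F A"
      using Z(4)[OF A(2,1)] z by blast
    moreover have "z \<notin> A"
      using A(1) z by blast
    moreover have "insert z A - {x} = insert z (A - {x})" if "x \<in> A" for x
      using that \<open>z \<notin> A\<close> by blast
    ultimately have "\<forall>x\<in>insert z A. x \<notin> F (insert z A - {x})"
      using A(4) by auto
    then show ?case
      using A z Z(2) \<open>z \<notin> A\<close> by (intro exI[of _ "insert z A"]) auto
  qed
  then show ?thesis
    using that by blast
qed

section \<open>Alternating sums over intervals of finite sets\<close>

lemma sum_subsets_by_card:
  fixes g :: "nat \<Rightarrow> 'b::comm_semiring_1"
  assumes "finite A"
  shows "(\<Sum>C | C \<subseteq> A \<and> card C \<le> r. g (card C)) = (\<Sum>j\<le>r. of_nat (card A choose j) * g j)"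
proof -
  have "(\<Sum>C | C \<subseteq> A \<and> card C \<le> r. g (card C)) =
      (\<Sum>j\<le>r. of_nat (card {C \<in> {C. C \<subseteq> A \<and> card C \<le> r}. card C = j}) * g j)"
    using assms by (intro sum_fun_comp) auto
  also have "\<dots> = (\<Sum>j\<le>r. of_nat (card A choose j) * g j)"
    using n_subsets[OF assms]
    by (intro sum.cong refl arg_cong2[where f = "(*)"] arg_cong[where f = of_nat]) 
       (smt (verit) Collect_cong atMost_iff mem_Collect_eq)
  finally show ?thesis .
qed

lemma alternating_binomial_partial_sum:
  assumes "0 < N"
  shows "(\<Sum>j\<le>r. real (N choose j) * (- 1) ^ j) = (- 1) ^ r * real ((N - 1) choose r)"
  using gbinomial_sum_lower_neg[of "real N" r] assms
  by (simp add: binomial_gbinomial of_nat_diff)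

lemma alternating_sum_interval_shift:
  assumes "finite A" "B \<subseteq> A"
  shows "(\<Sum>C | B \<subseteq> C \<and> C \<subseteq> A \<and> card C \<le> m. (- 1) ^ (card C + card B)) =
    (\<Sum>D | D \<subseteq> A - B \<and> card B + card D \<le> m. (- 1 :: real) ^ card D)"
proof -
  have finB: "finite B"
    using assms finite_subset by blast
  have cardU: "card (B \<union> D) = card B + card D" if "D \<subseteq> A - B" for D
    using that finB assms(1) finite_subset[of D A] by (intro card_Un_disjoint) auto
  show ?thesis
  proof (rule sum.reindex_bij_witness[of _ "\<lambda>D. B \<union> D" "\<lambda>C. C - B"])
    fix C assume C: "C \<in> {C. B \<subseteq> C \<and> C \<subseteq> A \<and> card C \<le> m}"
    then have "card C = card B + card (C - B)"
      using cardU[of "C - B"] by (simp add: Un_absorb1 Diff_mono)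
    then show "C - B \<in> {D. D \<subseteq> A - B \<and> card B + card D \<le> m}"
      "(- 1 :: real) ^ card (C - B) = (- 1) ^ (card C + card B)"
      using C by (auto simp: power_add)
  qed (use assms cardU in auto)
qed

lemma alternating_sum_truncated_interval:
  assumes "finite A" "m < card A" "B \<subseteq> A" "card B \<le> m"
  shows "(\<Sum>C | B \<subseteq> C \<and> C \<subseteq> A \<and> card C \<le> m. (- 1) ^ (card C + card B)) =
    (- 1) ^ (m - card B) * real ((card A - card B - 1) choose (m - card B))"
proof -
  have cardA: "card (A - B) = card A - card B"
    using assms finite_subset[of B A] by (simp add: card_Diff_subset)
  have "{D. D \<subseteq> A - B \<and> card B + card D \<le> m} = {D. D \<subseteq> A - B \<and> card D \<le> m - card B}"
    using assms(4) by auto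
  then have "(\<Sum>C | B \<subseteq> C \<and> C \<subseteq> A \<and> card C \<le> m. (- 1 :: real) ^ (card C + card B)) =
      (\<Sum>D | D \<subseteq> A - B \<and> card D \<le> m - card B. (- 1) ^ card D)"
    using alternating_sum_interval_shift[OF assms(1,3)] by simp
  also have "\<dots> = (\<Sum>j\<le>m - card B. real (card (A - B) choose j) * (- 1) ^ j)"
    using assms by (intro sum_subsets_by_card) auto
  also have "\<dots> = (- 1) ^ (m - card B) * real ((card A - card B - 1) choose (m - card B))"
    using assms by (subst alternating_binomial_partial_sum) (auto simp: cardA)
  finally show ?thesis .
qed

lemma sum_power_card_Pow:
  fixes x :: "'b::comm_ring_1"
  assumes "finite A"
  shows "(\<Sum>C\<in>Pow A. x ^ card C) = (1 + x) ^ card A"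
  using prod_add[OF assms, of "\<lambda>_. x" "\<lambda>_. 1"] by (simp add: add.commute)

section \<open>The topology of the spaces of finite sets\<close>

definition subsets_upto :: "nat \<Rightarrow> 'a set \<Rightarrow> 'a set set" where
  "subsets_upto n X = {A. A \<subseteq> X \<and> finite A \<and> card A \<le> n}"

lemma subsets_upto_finite:
  "finite A \<Longrightarrow> subsets_upto m A = {B. B \<subseteq> A \<and> card B \<le> m}"
  by (auto simp: subsets_upto_def intro: finite_subset)

lemma finite_subsets_upto: "finite A \<Longrightarrow> finite (subsets_upto m A)"
  by (simp add: subsets_upto_finite)

lemma subsets_upto_subset:
  assumes "A \<in> subsets_upto n X" "B \<subseteq> A"
  shows "B \<in> subsets_upto n X"
  using assms card_mono[of A B] finite_subset[of B A] by (auto simp: subsets_upto_def)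

lemma subsets_upto_mono: "m \<le> n \<Longrightarrow> A \<subseteq> X \<Longrightarrow> subsets_upto m A \<subseteq> subsets_upto n X"
  by (auto simp: subsets_upto_def)

lemma chi_apply: "x \<in> X \<Longrightarrow> chi X A x = (if x \<in> A then 1 else 0)"
  by (simp add: chi_def indicator_def)

lemma support_chi: "A \<subseteq> X \<Longrightarrow> {x \<in> X. chi X A x = 1} = A"
  by (auto simp: chi_apply split: if_splits)

lemma sigma_set_eq: "sigma_set n X = chi X ` subsets_upto n X"
  by (auto simp: sigma_set_def subsets_upto_def)

lemma topspace_sigma_top: "topspace (sigma_top n X) = chi X ` subsets_upto n X"
  by (auto simp: sigma_top_def sigma_set_eq chi_def indicator_def)

lemma subtopology_sigma_top:
  "m \<le> n \<Longrightarrow> subtopology (sigma_top n X) (sigma_set m X) = sigma_top m X"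
  using image_mono[OF subsets_upto_mono[of m n X X], of "chi X"]
  by (simp add: sigma_top_def subtopology_subtopology sigma_set_eq Int_absorb1)

text \<open>The basic neighbourhoods of \<open>A\<close> consist of the sets with the same trace on a finite set \<open>F\<close>.\<close>

lemma continuous_map_sigma_top_iff:
  "continuous_map (sigma_top n X) euclideanreal g \<longleftrightarrow>
    (\<forall>A\<in>subsets_upto n X. \<forall>e>0. \<exists>F. finite F \<and> F \<subseteq> X \<and>
      (\<forall>A'\<in>subsets_upto n X. A' \<inter> F = A \<inter> F \<longrightarrow> \<bar>g (chi X A') - g (chi X A)\<bar> < e))"
    (is "?lhs \<longleftrightarrow> ?rhs")
proof
  let ?P = "product_topology (\<lambda>_. discrete_topology {0, 1 :: nat}) X"
  assume L: ?lhs
  show ?rhs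
  proof (intro ballI allI impI)
    fix A and e :: real
    assume A: "A \<in> subsets_upto n X" and e: "0 < e"
    have "openin (sigma_top n X) {a \<in> topspace (sigma_top n X). g a \<in> ball (g (chi X A)) e}"
      using L by (intro openin_continuous_map_preimage[of _ euclideanreal]) auto
    then obtain V where V: "openin ?P V"
      "{a \<in> topspace (sigma_top n X). g a \<in> ball (g (chi X A)) e} = V \<inter> sigma_set n X"
      unfolding sigma_top_def openin_subtopology by auto
    have "chi X A \<in> V"
    proof -
      have "chi X A \<in> {a \<in> topspace (sigma_top n X). g a \<in> ball (g (chi X A)) e}"
        using A e by (simp add: topspace_sigma_top)
      then show ?thesis
        unfolding V(2) by blast
    qed
    then obtain U where U: "finite {x \<in> X. U x \<noteq> {0, 1}}" "chi X A \<in> Pi\<^sub>E X U" "Pi\<^sub>E X U \<subseteq> V"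
      using V(1) unfolding openin_product_topology_alt by auto
    have "\<bar>g (chi X A') - g (chi X A)\<bar> < e"
      if A': "A' \<in> subsets_upto n X" "A' \<inter> {x \<in> X. U x \<noteq> {0, 1}} = A \<inter> {x \<in> X. U x \<noteq> {0, 1}}"
      for A'
    proof -
      have "chi X A' x \<in> U x" if x: "x \<in> X" for x
      proof (cases "U x = {0, 1}")
        case False
        then have "x \<in> A' \<longleftrightarrow> x \<in> A"
          using A'(2) x by blast
        then have "chi X A' x = chi X A x"
          using x by (simp add: chi_apply)
        then show ?thesis
          using PiE_mem[OF U(2) x] by simp
      qed (use x in \<open>auto simp: chi_apply\<close>)
      then have "chi X A' \<in> V"
        using U(3) by (auto simp: chi_def)
      then have "chi X A' \<in> V \<inter> sigma_set n X"
        using A'(1) by (auto simp: sigma_set_eq)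
      then show ?thesis
        unfolding V(2)[symmetric] by (auto simp: dist_real_def)
    qed
    then show "\<exists>F. finite F \<and> F \<subseteq> X \<and>
      (\<forall>A'\<in>subsets_upto n X. A' \<inter> F = A \<inter> F \<longrightarrow> \<bar>g (chi X A') - g (chi X A)\<bar> < e)"
      using U(1) by (intro exI[of _ "{x \<in> X. U x \<noteq> {0, 1}}"]) auto
  qed
next
  let ?P = "product_topology (\<lambda>_. discrete_topology {0, 1 :: nat}) X"
  assume R: ?rhs
  show ?lhs
    unfolding continuous_map_eq_topcontinuous_at topcontinuous_at_def topspace_sigma_top
  proof (intro ballI conjI allI impI)
    fix a W
    assume a: "a \<in> chi X ` subsets_upto n X" and W: "openin euclideanreal W \<and> g a \<in> W"
    from a obtain A where A: "A \<in> subsets_upto n X" "a = chi X A"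
      by blast
    from W obtain e where e: "0 < e" "ball (g a) e \<subseteq> W"
      using open_contains_ball by (metis open_openin)
    from R A(1) e(1) obtain F where F: "finite F" "F \<subseteq> X"
      "\<And>A'. A' \<in> subsets_upto n X \<Longrightarrow> A' \<inter> F = A \<inter> F \<Longrightarrow> \<bar>g (chi X A') - g (chi X A)\<bar> < e"
      by meson
    define U where "U x = (if x \<in> F then {chi X A x} else {0, 1})" for x
    have "openin ?P (Pi\<^sub>E X U)"
      unfolding openin_PiE_gen
    proof (intro disjI2 conjI ballI)
      show "finite {x \<in> X. U x \<noteq> topspace (discrete_topology {0, 1})}"
        using F(1) by (rule rev_finite_subset) (auto simp: U_def)
    qed (auto simp: U_def chi_apply)
    then have "openin (sigma_top n X) (Pi\<^sub>E X U \<inter> sigma_set n X)"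
      by (auto simp: sigma_top_def openin_subtopology)
    moreover have "a \<in> Pi\<^sub>E X U \<inter> sigma_set n X"
      using A by (auto simp: sigma_set_eq U_def chi_apply) (auto simp: chi_def)
    moreover have "g b \<in> W" if b: "b \<in> Pi\<^sub>E X U \<inter> sigma_set n X" for b
    proof -
      obtain A' where A': "A' \<in> subsets_upto n X" "b = chi X A'"
        using b by (auto simp: sigma_set_eq)
      have "x \<in> A' \<longleftrightarrow> x \<in> A" if "x \<in> F" for x
      proof -
        have "chi X A' x = chi X A x"
          using PiE_mem[of b X U x] b that F(2) A'(2) by (auto simp: U_def)
        then show ?thesis
          using that F(2) by (auto simp: chi_apply split: if_splits)
      qed
      then have "\<bar>g b - g a\<bar> < e"
        using F(3)[OF A'(1)] A A' by blast
      then show ?thesis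
        using e(2) by (auto simp: dist_real_def subset_iff)
    qed
    ultimately show "\<exists>U. openin (sigma_top n X) U \<and> a \<in> U \<and> (\<forall>y\<in>U. g y \<in> W)"
      by blast
  qed auto
qed

lemma continuous_sigma_top_uniform_witness:
  assumes "continuous_map (sigma_top n X) euclideanreal g" "\<A> \<subseteq> subsets_upto n X" "finite \<A>" "0 < e"
  obtains F where "finite F" "F \<subseteq> X"
    "\<And>A A'. A \<in> \<A> \<Longrightarrow> A' \<in> subsets_upto n X \<Longrightarrow> A' \<inter> F = A \<inter> F \<Longrightarrow>
      \<bar>g (chi X A') - g (chi X A)\<bar> < e"
proof -
  have "\<forall>A\<in>\<A>. \<exists>F. finite F \<and> F \<subseteq> X \<and>
      (\<forall>A'\<in>subsets_upto n X. A' \<inter> F = A \<inter> F \<longrightarrow> \<bar>g (chi X A') - g (chi X A)\<bar> < e)"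
    using assms unfolding continuous_map_sigma_top_iff by (meson subsetD)
  then have "\<exists>F. \<forall>A\<in>\<A>. finite (F A) \<and> F A \<subseteq> X \<and>
      (\<forall>A'\<in>subsets_upto n X. A' \<inter> F A = A \<inter> F A \<longrightarrow> \<bar>g (chi X A') - g (chi X A)\<bar> < e)"
    by (rule bchoice)
  then obtain F where F: "\<forall>A\<in>\<A>. finite (F A) \<and> F A \<subseteq> X \<and>
      (\<forall>A'\<in>subsets_upto n X. A' \<inter> F A = A \<inter> F A \<longrightarrow> \<bar>g (chi X A') - g (chi X A)\<bar> < e)" ..
  show thesis
  proof (rule that[of "\<Union>(F ` \<A>)"])
    fix A A' assume H: "A \<in> \<A>" "A' \<in> subsets_upto n X" "A' \<inter> \<Union>(F ` \<A>) = A \<inter> \<Union>(F ` \<A>)"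
    then have "A' \<inter> F A = A \<inter> F A"
      by blast
    then show "\<bar>g (chi X A') - g (chi X A)\<bar> < e"
      using F H by blast
  qed (use F assms(3) in auto)
qed

section \<open>The canonical operator as a truncated Moebius inversion\<close>

text \<open>The coefficient of \<open>f (chi X B)\<close> in the value of the canonical extension of \<open>f\<close> at \<open>chi X A\<close>.
  Compared with the binomial formula, which is \<open>ext_weight_eq\<close> below, this form also covers
  \<open>card A \<le> m\<close>. Exponents are sums and not differences because only their parity matters and
  subtraction of natural numbers truncates.\<close>

definition ext_weight :: "nat \<Rightarrow> 'a set \<Rightarrow> 'a set \<Rightarrow> real" where
  "ext_weight m A B = (\<Sum>C | B \<subseteq> C \<and> C \<subseteq> A \<and> card C \<le> m. (- 1) ^ (card C + card B))"

lemma ext_weight_eq: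
  assumes "finite A" "m < card A" "B \<subseteq> A" "card B \<le> m"
  shows "ext_weight m A B =
    (- 1) ^ (m - card B) * real ((card A - card B - 1) choose (m - card B))"
  unfolding ext_weight_def by (rule alternating_sum_truncated_interval[OF assms])

definition moebius :: "('a set \<Rightarrow> real) \<Rightarrow> 'a set \<Rightarrow> real" where
  "moebius h C = (\<Sum>B\<in>Pow C. (- 1) ^ (card C + card B) * h B)"

lemma sum_moebius_truncated:
  assumes "finite A"
  shows "(\<Sum>C\<in>subsets_upto m A. moebius h C) =
    (\<Sum>B\<in>subsets_upto m A. ext_weight m A B * h B)"
proof -
  have "(\<Sum>C\<in>subsets_upto m A. moebius h C) =
      (\<Sum>C\<in>subsets_upto m A. \<Sum>B | B \<in> subsets_upto m A \<and> B \<subseteq> C.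
        (- 1) ^ (card C + card B) * h B)"
    unfolding moebius_def
    by (intro sum.cong refl) (auto simp: Pow_def subsets_upto_def intro: card_mono finite_subset order_trans)
  also have "\<dots> = (\<Sum>B\<in>subsets_upto m A. \<Sum>C | C \<in> subsets_upto m A \<and> B \<subseteq> C.
        (- 1) ^ (card C + card B) * h B)"
    using assms by (intro sum.swap_restrict finite_subsets_upto)
  also have "\<dots> = (\<Sum>B\<in>subsets_upto m A. ext_weight m A B * h B)"
    unfolding ext_weight_def sum_distrib_right using assms
    by (intro sum.cong refl) (auto simp: subsets_upto_finite)
  finally show ?thesis .
qed

text \<open>Moebius inversion on the lattice of subsets of \<open>A\<close>: the alternating sum over the interval from
  \<open>B\<close> to \<open>A\<close> vanishes unless \<open>B = A\<close>.\<close>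

lemma sum_moebius:
  assumes "finite A"
  shows "(\<Sum>C\<in>Pow A. moebius h C) = h A"
proof -
  have "subsets_upto (card A) A = Pow A"
    using assms by (auto simp: subsets_upto_finite card_mono)
  moreover have "ext_weight (card A) A B = (if B = A then 1 else 0)"
    if B: "B \<subseteq> A" for B
  proof -
    have "card B + card D \<le> card A" if "D \<subseteq> A - B" for D
    proof -
      have "card B + card D = card (B \<union> D)"
        using that B assms finite_subset[of _ A] by (intro card_Un_disjoint[symmetric]) auto
      also have "\<dots> \<le> card A"
        using that B assms by (intro card_mono) auto
      finally show ?thesis .
    qed
    then have "{D. D \<subseteq> A - B \<and> card B + card D \<le> card A} = Pow (A - B)"
      by auto
    then have "ext_weight (card A) A B = (\<Sum>D\<in>Pow (A - B). (- 1) ^ card D)"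
      using alternating_sum_interval_shift[OF assms B, of "card A"] by (simp add: ext_weight_def)
    also have "\<dots> = (if B = A then 1 else 0)"
      using B assms by (subst sum_power_card_Pow) (auto simp: power_0_left)
    finally show ?thesis .
  qed
  ultimately show ?thesis
    using sum_moebius_truncated[OF assms, of h "card A"] assms
    by simp (subst sum.cong[OF refl, where h = "\<lambda>B. if B = A then h B else 0"]; simp)
qed

lemma canonical_ext_small:
  assumes A: "A \<in> subsets_upto n X" "card A \<le> m"
  shows "canonical_ext m n X f (chi X A) = f (chi X A)"
proof -
  have "A \<subseteq> X"
    using A by (auto simp: subsets_upto_def)
  then show ?thesis
    using A by (simp add: canonical_ext_def sigma_set_eq support_chi[unfolded One_nat_def] Let_def)
qed

text \<open>One formula for both cases of the definition: for small \<open>A\<close> it is Moebius inversion, for large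
  \<open>A\<close> the coefficients are alternating binomial sums cut off at level \<open>m\<close>.\<close>

lemma canonical_ext_eq_sum_moebius:
  assumes A: "A \<in> subsets_upto n X"
  shows "canonical_ext m n X f (chi X A) =
    (\<Sum>C\<in>subsets_upto m A. moebius (\<lambda>B. f (chi X B)) C)"
proof -
  have fin: "finite A"
    using A by (auto simp: subsets_upto_def)
  show ?thesis
  proof (cases "card A \<le> m")
    case True
    then have "subsets_upto m A = Pow A"
      using fin card_mono[OF fin] by (auto simp: subsets_upto_finite intro: order_trans)
    then show ?thesis
      using canonical_ext_small[OF A True] sum_moebius[OF fin] by simp
  next
    case False
    then have "m < card A"
      by simp
    have "A \<subseteq> X"
      using A by (auto simp: subsets_upto_def)
    have "canonical_ext m n X f (chi X A) = (\<Sum>B\<in>subsets_upto m A. (- 1) ^ (m - card B) *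
        real ((card A - card B - 1) choose (m - card B)) * f (chi X B))"
      using A \<open>A \<subseteq> X\<close> \<open>m < card A\<close> fin
      by (simp add: canonical_ext_def sigma_set_eq support_chi[unfolded One_nat_def] Let_def
          subsets_upto_finite)
    also have "\<dots> = (\<Sum>B\<in>subsets_upto m A. ext_weight m A B * f (chi X B))"
      by (intro sum.cong refl) (auto simp: subsets_upto_def ext_weight_eq[OF fin \<open>m < card A\<close>])
    finally show ?thesis
      using sum_moebius_truncated[OF fin] by simp
  qed
qed

lemma canonical_ext_weighted:
  assumes "A \<in> subsets_upto n X"
  shows "canonical_ext m n X f (chi X A) = (\<Sum>B\<in>subsets_upto m A. ext_weight m A B * f (chi X B))"
proof -
  have "finite A"
    using assms by (simp add: subsets_upto_def)
  then show ?thesis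
    using canonical_ext_eq_sum_moebius[OF assms, of m f] sum_moebius_truncated by simp
qed

section \<open>The canonical operator is an extension operator of small norm\<close>

definition ext_const :: "nat \<Rightarrow> nat \<Rightarrow> nat" where
  "ext_const m n = (\<Sum>k=0..m. (n choose k) * ((n - k - 1) choose (m - k)))"

lemma ext_const_mono: "a \<le> n \<Longrightarrow> ext_const m a \<le> ext_const m n"
  unfolding ext_const_def by (intro sum_mono mult_mono binomial_right_mono) auto

lemma ext_const_ge_1:
  assumes "m < n"
  shows "1 \<le> ext_const m n"
proof -
  have "1 \<le> n choose m"
    using assms by (simp add: Suc_le_eq)
  also have "\<dots> = (n choose m) * ((n - m - 1) choose (m - m))"
    by simp
  also have "\<dots> \<le> ext_const m n"
    unfolding ext_const_def by (rule member_le_sum) auto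
  finally show ?thesis .
qed

lemma sum_subsets_upto_binomial:
  assumes "finite A"
  shows "(\<Sum>B\<in>subsets_upto m A. real ((card A - card B - 1) choose (m - card B))) =
    real (ext_const m (card A))"
  using sum_subsets_by_card[OF assms, of "\<lambda>k. real ((card A - k - 1) choose (m - k))" m] assms
  by (simp add: subsets_upto_finite ext_const_def atLeast0AtMost)

lemma canonical_ext_bound:
  assumes "m < n" and A: "A \<in> subsets_upto n X"
    and f: "\<And>B. B \<in> subsets_upto m X \<Longrightarrow> \<bar>f (chi X B)\<bar> \<le> s"
  shows "\<bar>canonical_ext m n X f (chi X A)\<bar> \<le> real (ext_const m n) * s"
proof -
  have "0 \<le> s"
    using f[of "{}"] by (simp add: subsets_upto_def)
  have A': "A \<subseteq> X" "finite A" "card A \<le> n"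
    using A by (auto simp: subsets_upto_def)
  show ?thesis
  proof (cases "card A \<le> m")
    case True
    then have "\<bar>canonical_ext m n X f (chi X A)\<bar> \<le> 1 * s"
      using A' f canonical_ext_small[OF A True, of f] by (simp add: subsets_upto_def)
    also have "\<dots> \<le> real (ext_const m n) * s"
      using ext_const_ge_1[OF \<open>m < n\<close>] \<open>0 \<le> s\<close> by (intro mult_right_mono) auto
    finally show ?thesis .
  next
    case False
    then have "m < card A"
      by simp
    have "\<bar>canonical_ext m n X f (chi X A)\<bar> \<le>
        (\<Sum>B\<in>subsets_upto m A. \<bar>ext_weight m A B * f (chi X B)\<bar>)"
      unfolding canonical_ext_weighted[OF A] by (rule sum_abs)
    also have "\<dots> \<le> (\<Sum>B\<in>subsets_upto m A. real ((card A - card B - 1) choose (m - card B)) * s)"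
    proof (rule sum_mono)
      fix B assume B: "B \<in> subsets_upto m A"
      then have "\<bar>ext_weight m A B\<bar> = real ((card A - card B - 1) choose (m - card B))"
        using ext_weight_eq[OF A'(2) \<open>m < card A\<close>, of B]
        by (simp add: subsets_upto_def abs_mult power_abs)
      moreover have "\<bar>f (chi X B)\<bar> \<le> s"
        using f subsets_upto_mono[of m m A X] A'(1) B by auto
      ultimately show "\<bar>ext_weight m A B * f (chi X B)\<bar> \<le>
          real ((card A - card B - 1) choose (m - card B)) * s"
        by (simp add: abs_mult mult_left_mono)
    qed
    also have "\<dots> = real (ext_const m (card A)) * s"
      using sum_subsets_upto_binomial[OF A'(2)] by (simp flip: sum_distrib_right)
    also have "\<dots> \<le> real (ext_const m n) * s"
      using ext_const_mono[OF A'(3)] \<open>0 \<le> s\<close> by (intro mult_right_mono) auto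
    finally show ?thesis .
  qed
qed

text \<open>Adding or removing a fixed element of \<open>C - A\<close> is a sign-reversing involution on the subsets of
  \<open>C\<close> that does not change their trace on \<open>A\<close>.\<close>

lemma moebius_trace_eq_0:
  assumes "finite C" "\<not> C \<subseteq> A"
  shows "moebius (\<lambda>B. h (B \<inter> A)) C = 0"
proof -
  obtain c where c: "c \<in> C" "c \<notin> A"
    using assms(2) by blast
  define toggle where "toggle = (\<lambda>B. if c \<in> B then B - {c} else insert c B)"
  have flip: "(- 1 :: real) ^ card (toggle B) = - ((- 1) ^ card B)" if "B \<subseteq> C" for B
  proof (cases "c \<in> B")
    case True
    then have "card B = Suc (card (B - {c}))"
      using finite_subset[OF that assms(1)] by (intro card.remove)
    then have "(- 1 :: real) ^ card B = - ((- 1) ^ card (B - {c}))"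
      by (simp only: power_Suc mult_minus1)
    then show ?thesis
      using True by (simp add: toggle_def)
  qed (use finite_subset[OF that assms(1)] in \<open>simp add: toggle_def\<close>)
  have "moebius (\<lambda>B. h (B \<inter> A)) C = (\<Sum>B\<in>Pow C. - ((- 1) ^ (card C + card B) * h (B \<inter> A)))"
    unfolding moebius_def
  proof (rule sum.reindex_bij_witness[of _ toggle toggle])
    fix B assume B: "B \<in> Pow C"
    have "toggle B \<inter> A = B \<inter> A"
      using c by (auto simp: toggle_def)
    then show "- ((- 1) ^ (card C + card (toggle B)) * h (toggle B \<inter> A)) =
        (- 1) ^ (card C + card B) * h (B \<inter> A)"
      using flip[of B] B by (simp add: power_add)
  qed (use c in \<open>auto simp: toggle_def split: if_splits\<close>)
  also have "\<dots> = - moebius (\<lambda>B. h (B \<inter> A)) C"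
    by (simp add: moebius_def sum_negf)
  finally show ?thesis
    by simp
qed

lemma moebius_small:
  assumes "finite C" "\<not> C \<subseteq> A" and h: "\<And>B. B \<subseteq> C \<Longrightarrow> \<bar>h B - h (B \<inter> A)\<bar> \<le> e"
  shows "\<bar>moebius h C\<bar> \<le> 2 ^ card C * e"
proof -
  have "\<bar>moebius h C\<bar> = \<bar>moebius h C - moebius (\<lambda>B. h (B \<inter> A)) C\<bar>"
    using moebius_trace_eq_0[OF assms(1,2), of h] by simp
  also have "\<dots> = \<bar>\<Sum>B\<in>Pow C. (- 1) ^ (card C + card B) * (h B - h (B \<inter> A))\<bar>"
    by (simp add: moebius_def right_diff_distrib sum_subtractf)
  also have "\<dots> \<le> (\<Sum>B\<in>Pow C. \<bar>(- 1) ^ (card C + card B) * (h B - h (B \<inter> A))\<bar>)"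
    by (rule sum_abs)
  also have "\<dots> \<le> (\<Sum>B\<in>Pow C. e)"
    using h by (intro sum_mono) (auto simp: abs_mult power_abs)
  also have "\<dots> = 2 ^ card C * e"
    using assms(1) by (simp add: card_Pow)
  finally show ?thesis .
qed

text \<open>If \<open>A'\<close> is close to \<open>A\<close>, then \<open>A \<subseteq> A'\<close>, and the values of the extension at the two sets differ
  by the sum of the Moebius coefficients of the sets \<open>C \<subseteq> A'\<close> that are not contained in \<open>A\<close>. There
  are at most \<open>2 ^ n\<close> of these, each at most \<open>2 ^ m * d\<close> by \<open>moebius_small\<close>, since \<open>f\<close> hardly
  distinguishes \<open>B\<close> from its trace \<open>B \<inter> A\<close>.\<close>

lemma canonical_ext_continuous:
  assumes f: "continuous_map (sigma_top m X) euclideanreal f"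
  shows "continuous_map (sigma_top n X) euclideanreal (canonical_ext m n X f)"
  unfolding continuous_map_sigma_top_iff
proof (intro ballI allI impI)
  fix A and e :: real
  assume A: "A \<in> subsets_upto n X" and "0 < e"
  have A': "A \<subseteq> X" "finite A"
    using A by (auto simp: subsets_upto_def)
  define d where "d = e / (2 * 2 ^ n * 2 ^ m)"
  have "0 < d"
    using \<open>0 < e\<close> by (simp add: d_def)
  have sub: "subsets_upto m A \<subseteq> subsets_upto m X"
    using A' by (intro subsets_upto_mono) auto
  obtain F where F: "finite F" "F \<subseteq> X"
    "\<And>B B'. B \<in> subsets_upto m A \<Longrightarrow> B' \<in> subsets_upto m X \<Longrightarrow> B' \<inter> F = B \<inter> F \<Longrightarrow>
      \<bar>f (chi X B') - f (chi X B)\<bar> < d"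
    using continuous_sigma_top_uniform_witness[OF f sub finite_subsets_upto[OF A'(2)] \<open>0 < d\<close>]
    by blast
  let ?h = "\<lambda>B. f (chi X B)"
  have "\<bar>canonical_ext m n X f (chi X A') - canonical_ext m n X f (chi X A)\<bar> < e"
    if A1: "A' \<in> subsets_upto n X" "A' \<inter> (F \<union> A) = A \<inter> (F \<union> A)" for A'
  proof -
    have A2: "A' \<subseteq> X" "finite A'" "card A' \<le> n" "A \<subseteq> A'" "A' \<inter> F \<subseteq> A"
      using A1 by (auto simp: subsets_upto_def)
    let ?D = "subsets_upto m A' - subsets_upto m A"
    have "canonical_ext m n X f (chi X A') - canonical_ext m n X f (chi X A) =
        (\<Sum>C\<in>?D. moebius ?h C)"
      unfolding canonical_ext_eq_sum_moebius[OF A] canonical_ext_eq_sum_moebius[OF A1(1)]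
      using A2 by (subst sum_diff) (auto intro: finite_subsets_upto subsetD[OF subsets_upto_mono])
    also have "\<bar>\<dots>\<bar> \<le> (\<Sum>C\<in>?D. \<bar>moebius ?h C\<bar>)"
      by (rule sum_abs)
    also have "\<dots> \<le> (\<Sum>C\<in>?D. 2 ^ m * d)"
    proof (rule sum_mono)
      fix C assume C: "C \<in> ?D"
      then have C': "finite C" "C \<subseteq> A'" "card C \<le> m" "\<not> C \<subseteq> A"
        by (auto simp: subsets_upto_def)
      have "\<bar>?h B - ?h (B \<inter> A)\<bar> \<le> d" if "B \<subseteq> C" for B
      proof -
        have CX: "C \<in> subsets_upto m X"
          using C' A2(1) by (auto simp: subsets_upto_def)
        have B: "B \<in> subsets_upto m X" "B \<inter> A \<in> subsets_upto m X"
          by (rule subsets_upto_subset[OF CX], use that in blast)+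
        then have "B \<inter> A \<in> subsets_upto m A"
          by (auto simp: subsets_upto_def)
        moreover have "B \<inter> F = B \<inter> A \<inter> F"
          using that C'(2) A2(5) by blast
        ultimately show ?thesis
          using F(3)[of "B \<inter> A" B] B by simp
      qed
      then have "\<bar>moebius ?h C\<bar> \<le> 2 ^ card C * d"
        using moebius_small[OF C'(1,4), of ?h d] by blast
      also have "\<dots> \<le> 2 ^ m * d"
        using C'(3) \<open>0 < d\<close> by (intro mult_right_mono power_increasing) auto
      finally show "\<bar>moebius ?h C\<bar> \<le> 2 ^ m * d" .
    qed
    also have "\<dots> = real (card ?D) * (2 ^ m * d)"
      by simp
    also have "\<dots> \<le> 2 ^ n * (2 ^ m * d)"
    proof (rule mult_right_mono)
      have "card ?D \<le> card (Pow A')"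
        using A2 by (intro card_mono) (auto simp: subsets_upto_def)
      also have "\<dots> \<le> 2 ^ n"
        using A2 by (simp add: card_Pow)
      finally show "real (card ?D) \<le> 2 ^ n"
        by (metis of_nat_le_iff of_nat_numeral of_nat_power)
    qed (use \<open>0 < d\<close> in simp)
    also have "\<dots> < e"
      using \<open>0 < e\<close> by (simp add: d_def field_simps)
    finally show ?thesis .
  qed
  then show "\<exists>F. finite F \<and> F \<subseteq> X \<and> (\<forall>A'\<in>subsets_upto n X. A' \<inter> F = A \<inter> F \<longrightarrow>
      \<bar>canonical_ext m n X f (chi X A') - canonical_ext m n X f (chi X A)\<bar> < e)"
    using F(1,2) A' by (intro exI[of _ "F \<union> A"]) auto
qed

lemma sup_norm_le_iff:
  "0 \<le> s \<Longrightarrow> sup_norm K f \<le> ennreal s \<longleftrightarrow> (\<forall>x\<in>topspace K. \<bar>f x\<bar> \<le> s)"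
  by (auto simp: sup_norm_def SUP_le_iff)

lemma canonical_ext_sup_norm:
  assumes "m < n"
  shows "sup_norm (sigma_top n X) (canonical_ext m n X f) \<le>
    ennreal (real (ext_const m n)) * sup_norm (sigma_top m X) f"
proof (cases "sup_norm (sigma_top m X) f" rule: ennreal_cases)
  case (real s)
  then have "\<bar>f (chi X B)\<bar> \<le> s" if "B \<in> subsets_upto m X" for B
    using sup_norm_le_iff[of s "sigma_top m X" f] that by (auto simp: topspace_sigma_top)
  then have "sup_norm (sigma_top n X) (canonical_ext m n X f) \<le> ennreal (real (ext_const m n) * s)"
    using canonical_ext_bound[OF assms, of _ X f s] \<open>0 \<le> s\<close>
    by (auto simp: sup_norm_le_iff topspace_sigma_top)
  then show ?thesis
    using real by (simp add: ennreal_mult)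
next
  case top
  then show ?thesis
    using ext_const_ge_1[OF assms] by (simp add: ennreal_mult_top)
qed

lemma canonical_ext_op_norm_le:
  assumes "m < n"
  shows "op_norm (sigma_top m X) (sigma_top n X) (canonical_ext m n X) \<le> of_nat (ext_const m n)"
  unfolding op_norm_def
proof (rule SUP_least)
  fix f assume "f \<in> {f \<in> cont_fun (sigma_top m X). sup_norm (sigma_top m X) f \<le> 1}"
  then have "ennreal (real (ext_const m n)) * sup_norm (sigma_top m X) f \<le>
      ennreal (real (ext_const m n)) * 1"
    by (intro mult_left_mono) auto
  then show "sup_norm (sigma_top n X) (canonical_ext m n X f) \<le> of_nat (ext_const m n)"
    using canonical_ext_sup_norm[OF assms, of X f]
    by (simp add: ennreal_of_nat_eq_real_of_nat)
qed

lemma canonical_ext_extension_operator: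
  assumes "m < n"
  shows "extension_operator (sigma_set m X) (sigma_top n X) (canonical_ext m n X)"
proof -
  have top: "chi X B \<in> topspace (sigma_top m X)" if "B \<in> subsets_upto m A" "A \<in> subsets_upto n X" for A B
    using that by (auto simp: topspace_sigma_top subsets_upto_def)
  have topn: "topspace (sigma_top n X) = sigma_set n X"
    by (simp add: topspace_sigma_top sigma_set_eq)
  have ext: "canonical_ext m n X f \<in> extensional (sigma_set n X)" for f
    by (simp add: canonical_ext_def)
  have "bounded_linear_op (sigma_top m X) (sigma_top n X) (canonical_ext m n X)"
    unfolding bounded_linear_op_def
  proof (intro conjI ballI allI exI)
    fix f g assume f: "f \<in> cont_fun (sigma_top m X)"
    show "canonical_ext m n X f \<in> cont_fun (sigma_top n X)"
      using f canonical_ext_continuous ext by (auto simp: cont_fun_def topn)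
    show "canonical_ext m n X (\<lambda>x\<in>topspace (sigma_top m X). f x + g x) =
        (\<lambda>y\<in>topspace (sigma_top n X). canonical_ext m n X f y + canonical_ext m n X g y)"
    proof (rule extensionalityI[OF ext])
      fix y assume "y \<in> sigma_set n X"
      then obtain A where "A \<in> subsets_upto n X" "y = chi X A"
        by (auto simp: sigma_set_eq)
      then show "canonical_ext m n X (\<lambda>x\<in>topspace (sigma_top m X). f x + g x) y =
        (\<lambda>y\<in>topspace (sigma_top n X). canonical_ext m n X f y + canonical_ext m n X g y) y"
        using top by (simp add: canonical_ext_weighted topspace_sigma_top flip: sum.distrib)
          (simp add: distrib_left flip: topspace_sigma_top)
    qed (simp add: topn)
    show "sup_norm (sigma_top n X) (canonical_ext m n X f) \<le>
        ennreal (real (ext_const m n)) * sup_norm (sigma_top m X) f"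
      using canonical_ext_sup_norm[OF assms] .
  next
    fix c :: real and f assume "f \<in> cont_fun (sigma_top m X)"
    show "canonical_ext m n X (\<lambda>x\<in>topspace (sigma_top m X). c * f x) =
        (\<lambda>y\<in>topspace (sigma_top n X). c * canonical_ext m n X f y)"
    proof (rule extensionalityI[OF ext])
      fix y assume "y \<in> sigma_set n X"
      then obtain A where "A \<in> subsets_upto n X" "y = chi X A"
        by (auto simp: sigma_set_eq)
      then show "canonical_ext m n X (\<lambda>x\<in>topspace (sigma_top m X). c * f x) y =
        (\<lambda>y\<in>topspace (sigma_top n X). c * canonical_ext m n X f y) y"
        using top by (simp add: canonical_ext_weighted topspace_sigma_top sum_distrib_left)
          (simp add: mult.left_commute flip: topspace_sigma_top)
    qed (simp add: topn)
  qed
  moreover have "restrict (canonical_ext m n X f) (sigma_set m X) = f"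
    if f: "f \<in> cont_fun (sigma_top m X)" for f
  proof (rule extensionalityI)
    show "f \<in> extensional (sigma_set m X)"
      using f by (simp add: cont_fun_def topspace_sigma_top sigma_set_eq)
    fix y assume y: "y \<in> sigma_set m X"
    then obtain A where "A \<in> subsets_upto m X" "y = chi X A"
      by (auto simp: sigma_set_eq)
    moreover from this have "A \<in> subsets_upto n X" "card A \<le> m"
      using assms by (auto simp: subsets_upto_def)
    ultimately show "restrict (canonical_ext m n X f) (sigma_set m X) y = f y"
      using y canonical_ext_small by simp
  qed simp
  ultimately show ?thesis
    using assms by (simp add: extension_operator_def subtopology_sigma_top)
qed

section \<open>Linearity for finite sums\<close>

lemma cont_fun_scale:
  assumes "f \<in> cont_fun K"
  shows "(\<lambda>x\<in>topspace K. c * f x) \<in> cont_fun K"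
  using assms unfolding cont_fun_def
  by (auto simp: continuous_map_real_mult_left intro: continuous_map_eq[of K euclideanreal "\<lambda>x. c * f x"])

lemma cont_fun_add:
  assumes "f \<in> cont_fun K" "g \<in> cont_fun K"
  shows "(\<lambda>x\<in>topspace K. f x + g x) \<in> cont_fun K"
  using assms unfolding cont_fun_def
  by (auto simp: continuous_map_add intro: continuous_map_eq[of K euclideanreal "\<lambda>x. f x + g x"])

lemma cont_fun_zero: "(\<lambda>x\<in>topspace K. 0) \<in> cont_fun K"
  unfolding cont_fun_def
  by (auto intro: continuous_map_eq[of K euclideanreal "\<lambda>x. 0"])

lemma bounded_linear_op_sum:
  assumes T: "bounded_linear_op L K T" and "finite I" "\<And>i. i \<in> I \<Longrightarrow> f i \<in> cont_fun L"
  shows "(\<lambda>x\<in>topspace L. \<Sum>i\<in>I. c i * f i x) \<in> cont_fun L \<and>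
    (\<forall>y\<in>topspace K. T (\<lambda>x\<in>topspace L. \<Sum>i\<in>I. c i * f i x) y = (\<Sum>i\<in>I. c i * T (f i) y))"
  using assms(2,3)
proof (induction I)
  case empty
  have "T (\<lambda>x\<in>topspace L. 0 * (\<lambda>x\<in>topspace L. 0) x) =
      (\<lambda>y\<in>topspace K. 0 * T (\<lambda>x\<in>topspace L. 0) y)"
    using T cont_fun_zero unfolding bounded_linear_op_def by blast
  then have "T (\<lambda>x\<in>topspace L. 0) = (\<lambda>y\<in>topspace K. 0)"
    by (simp cong: restrict_cong)
  then show ?case
    unfolding sum.empty by (intro conjI ballI cont_fun_zero) (simp only: restrict_apply')
next
  case (insert i I)
  let ?s = "\<lambda>x\<in>topspace L. \<Sum>i\<in>I. c i * f i x"
  let ?t = "\<lambda>x\<in>topspace L. c i * f i x"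
  have fi: "f i \<in> cont_fun L"
    using insert.prems by blast
  have "?s \<in> cont_fun L \<and> (\<forall>y\<in>topspace K. T ?s y = (\<Sum>i\<in>I. c i * T (f i) y))"
    by (rule insert.IH) (use insert.prems in blast)
  then have s: "?s \<in> cont_fun L"
    and IH: "\<And>y. y \<in> topspace K \<Longrightarrow> T ?s y = (\<Sum>i\<in>I. c i * T (f i) y)"
    by blast+
  have t: "?t \<in> cont_fun L"
    by (rule cont_fun_scale[OF fi])
  have eq: "(\<lambda>x\<in>topspace L. \<Sum>i\<in>insert i I. c i * f i x) = (\<lambda>x\<in>topspace L. ?t x + ?s x)"
    using insert.hyps by (auto simp: restrict_def)
  have "T (\<lambda>x\<in>topspace L. ?t x + ?s x) = (\<lambda>y\<in>topspace K. T ?t y + T ?s y)"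
    using T s t unfolding bounded_linear_op_def by blast
  moreover have "T ?t = (\<lambda>y\<in>topspace K. c i * T (f i) y)"
    using T fi unfolding bounded_linear_op_def by blast
  ultimately have "T (\<lambda>x\<in>topspace L. \<Sum>i\<in>insert i I. c i * f i x) y =
      (\<Sum>i\<in>insert i I. c i * T (f i) y)" if "y \<in> topspace K" for y
    unfolding eq using that IH insert.hyps by simp
  then show ?case
    using cont_fun_add[OF t s] unfolding eq by blast
qed

section \<open>Every extension operator has large norm\<close>

text \<open>As a function of the support of its argument, this is \<open>f\<^sub>C\<close>: the indicator of the sets that contain \<open>C\<close>.\<close>

definition containment :: "nat \<Rightarrow> 'a set \<Rightarrow> 'a set \<Rightarrow> ('a \<Rightarrow> nat) \<Rightarrow> real" where
  "containment m X C = (\<lambda>a\<in>topspace (sigma_top m X). if \<forall>x\<in>C. a x = 1 then 1 else 0)"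

lemma containment_chi:
  assumes "S \<in> subsets_upto m X" "C \<subseteq> X"
  shows "containment m X C (chi X S) = (if C \<subseteq> S then 1 else 0)"
proof -
  have "(\<forall>x\<in>C. chi X S x = 1) \<longleftrightarrow> C \<subseteq> S"
    using assms(2) by (auto simp: chi_apply subset_iff split: if_splits)
  then show ?thesis
    using assms(1) by (auto simp: containment_def topspace_sigma_top)
qed

lemma containment_cont_fun:
  assumes "finite C" "C \<subseteq> X"
  shows "containment m X C \<in> cont_fun (sigma_top m X)"
proof -
  have "continuous_map (sigma_top m X) euclideanreal (containment m X C)"
    unfolding continuous_map_sigma_top_iff
  proof (intro ballI allI impI exI[of _ C] conjI assms)
    fix A A' and e :: real
    assume "A \<in> subsets_upto m X" "A' \<in> subsets_upto m X" "A' \<inter> C = A \<inter> C" "0 < e"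
    moreover from this have "C \<subseteq> A' \<longleftrightarrow> C \<subseteq> A"
      by blast
    ultimately show "\<bar>containment m X C (chi X A') - containment m X C (chi X A)\<bar> < e"
      using assms(2) by (simp add: containment_chi)
  qed
  then show ?thesis
    by (simp add: cont_fun_def containment_def)
qed

text \<open>The Moebius transform of \<open>B \<mapsto> (-1) ^ (m + card B)\<close> at \<open>C\<close> is \<open>(-1) ^ m * (-2) ^ card C\<close>, and the
  signs of that function are those of the coefficients \<open>ext_weight m A B\<close>. So the sum equals the
  sum of the absolute values of these coefficients.\<close>

lemma ext_const_eq_sum_neg2:
  assumes "finite A" "m < card A"
  shows "(\<Sum>C\<in>subsets_upto m A. (- 1) ^ m * (- 2) ^ card C) = real (ext_const m (card A))"
proof -
  let ?h = "\<lambda>B. (- 1 :: real) ^ (m + card B)"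
  have "moebius ?h C = (- 1) ^ m * (- 2) ^ card C" if "finite C" for C :: "'a set"
  proof -
    have "(- 1 :: real) ^ (card C + card B) * ?h B = (- 1) ^ (m + card C)" for B :: "'a set"
      by (simp add: power_add)
    then have "moebius ?h C = (\<Sum>B\<in>Pow C. (- 1) ^ (m + card C))"
      unfolding moebius_def by (intro sum.cong refl) blast
    also have "\<dots> = (- 1) ^ m * (- 2) ^ card C"
      using that by (simp add: card_Pow power_add flip: power_mult_distrib)
    finally show ?thesis .
  qed
  then have "(\<Sum>C\<in>subsets_upto m A. (- 1) ^ m * (- 2) ^ card C) = (\<Sum>C\<in>subsets_upto m A. moebius ?h C)"
    by (intro sum.cong refl) (auto simp: subsets_upto_def)
  also have "\<dots> = (\<Sum>B\<in>subsets_upto m A. ext_weight m A B * ?h B)"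
    by (rule sum_moebius_truncated[OF assms(1)])
  also have "\<dots> = (\<Sum>B\<in>subsets_upto m A. real ((card A - card B - 1) choose (m - card B)))"
  proof (intro sum.cong refl)
    fix B assume "B \<in> subsets_upto m A"
    then have B: "B \<subseteq> A" "card B \<le> m"
      by (auto simp: subsets_upto_def)
    have "(- 1 :: real) ^ (m - card B) * ?h B = (- 1) ^ (2 * m)"
      using B(2) by (simp flip: power_add)
    then show "ext_weight m A B * ?h B = real ((card A - card B - 1) choose (m - card B))"
      using ext_weight_eq[OF assms B] by (simp add: mult.commute mult.left_commute)
  qed
  also have "\<dots> = real (ext_const m (card A))"
    by (rule sum_subsets_upto_binomial[OF assms(1)])
  finally show ?thesis .
qed

text \<open>Over all \<open>C \<subseteq> S \<inter> A\<close>, the sum of \<open>(-2) ^ card C\<close> is \<open>(1 - 2) ^ card (S \<inter> A)\<close>; the restriction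
  \<open>card C \<le> m\<close> loses none of these \<open>C\<close> because \<open>card S \<le> m\<close>.\<close>

lemma sum_neg2_containment:
  assumes "A \<subseteq> X" "finite A" "S \<in> subsets_upto m X"
  shows "(\<Sum>C\<in>subsets_upto m A. (- 1) ^ m * (- 2) ^ card C * containment m X C (chi X S)) =
    (- 1) ^ (m + card (S \<inter> A))"
proof -
  have S: "finite S" "card S \<le> m"
    using assms(3) by (auto simp: subsets_upto_def)
  have "(\<Sum>C\<in>subsets_upto m A. (- 1) ^ m * (- 2) ^ card C * containment m X C (chi X S)) =
      (\<Sum>C\<in>subsets_upto m A. if C \<subseteq> S then (- 1) ^ m * (- 2) ^ card C else 0)"
  proof (intro sum.cong refl)
    fix C assume "C \<in> subsets_upto m A"
    then have "C \<subseteq> X"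
      using assms(1) by (auto simp: subsets_upto_def)
    then show "(- 1) ^ m * (- 2) ^ card C * containment m X C (chi X S) =
        (if C \<subseteq> S then (- 1) ^ m * (- 2) ^ card C else 0)"
      by (simp add: containment_chi[OF assms(3)])
  qed
  also have "\<dots> = (\<Sum>C\<in>subsets_upto m A \<inter> {C. C \<subseteq> S}. (- 1) ^ m * (- 2) ^ card C)"
    using assms(2) by (simp add: sum.inter_restrict finite_subsets_upto)
  also have "subsets_upto m A \<inter> {C. C \<subseteq> S} = Pow (S \<inter> A)"
    using S card_mono[OF S(1)]
    by (auto simp: subsets_upto_def intro: finite_subset order_trans)
  also have "(\<Sum>C\<in>Pow (S \<inter> A). (- 1 :: real) ^ m * (- 2) ^ card C) = (- 1) ^ (m + card (S \<inter> A))"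
    using S(1) sum_power_card_Pow[of "S \<inter> A" "- 2 :: real"]
    by (simp add: power_add del: Pow_Int_eq flip: sum_distrib_left)
  finally show ?thesis .
qed

text \<open>At \<open>C\<close> the function \<open>T f\<^sub>C\<close> has the value \<open>f\<^sub>C(C) = 1\<close>. Each of the remaining points of \<open>A\<close>, added
  one at a time, changes the value by at most \<open>d\<close>.\<close>

lemma extension_value_near_1:
  assumes T: "extension_operator (sigma_set m X) (sigma_top n X) T" "m \<le> n"
    and A: "A \<subseteq> X" "finite A"
    and step: "\<And>D x C. x \<in> A \<Longrightarrow> D \<subseteq> A - {x} \<Longrightarrow> C \<in> subsets_upto m D \<Longrightarrow>
      \<bar>T (containment m X C) (chi X (insert x D)) - T (containment m X C) (chi X D)\<bar> \<le> d"
    and C: "C \<in> subsets_upto m A" and "0 \<le> d"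
  shows "\<bar>T (containment m X C) (chi X A) - 1\<bar> \<le> real (card A) * d"
proof -
  let ?T = "\<lambda>D. T (containment m X C) (chi X D)"
  have C': "C \<subseteq> A" "finite C" "card C \<le> m" "C \<in> subsets_upto m X"
    using C A by (auto simp: subsets_upto_def)
  have "\<bar>?T (C \<union> D) - 1\<bar> \<le> real (card D) * d" if "finite D" "D \<subseteq> A - C" for D
    using that
  proof (induction D)
    case empty
    have "restrict (T (containment m X C)) (sigma_set m X) = containment m X C"
      using T containment_cont_fun[of C X m] C' A(1)
      by (auto simp: extension_operator_def subtopology_sigma_top)
    then have "?T C = containment m X C (chi X C)"
      using C'(4) by (metis image_eqI restrict_apply' sigma_set_eq)
    also have "\<dots> = 1"
      using C'(1) A(1) containment_chi[OF C'(4), of C] by auto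
    finally show ?case
      by simp
  next
    case (insert x D)
    have "\<bar>?T (insert x (C \<union> D)) - ?T (C \<union> D)\<bar> \<le> d"
      using insert.prems insert.hyps C' by (intro step) (auto simp: subsets_upto_def)
    moreover have "\<bar>?T (C \<union> D) - 1\<bar> \<le> real (card D) * d"
      using insert by auto
    ultimately show ?case
      using insert.hyps by (simp add: algebra_simps)
  qed
  from this[of "A - C"] have "\<bar>?T A - 1\<bar> \<le> real (card (A - C)) * d"
    using A(2) C'(1) by (simp add: Un_absorb1)
  also have "\<dots> \<le> real (card A) * d"
    using A(2) \<open>0 \<le> d\<close> by (intro mult_right_mono) (auto intro: card_mono)
  finally show ?thesis .
qed

text \<open>For each \<open>D\<close> only finitely many \<open>x\<close> change one of the finitely many values by more than \<open>d\<close>.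
  Collecting these \<open>x\<close> over all \<open>D \<subseteq> E\<close> gives a map \<open>F\<close> with finite values; a free set for \<open>F\<close>
  is as required.\<close>

lemma generic_set_exists:
  fixes X K :: "'a set"
  assumes T: "bounded_linear_op (sigma_top m X) (sigma_top (Suc k) X) T"
    and "has_aleph k K" "|K| \<le>o |X|" "0 < d"
  obtains A where "A \<subseteq> X" "finite A" "card A = Suc k"
    "\<And>D x C. x \<in> A \<Longrightarrow> D \<subseteq> A - {x} \<Longrightarrow> C \<in> subsets_upto m D \<Longrightarrow>
      \<bar>T (containment m X C) (chi X (insert x D)) - T (containment m X C) (chi X D)\<bar> \<le> d"
proof -
  let ?n = "Suc k"
  define bad where "bad D = {x \<in> X - D. \<exists>C\<in>subsets_upto m D.
    d < \<bar>T (containment m X C) (chi X (insert x D)) - T (containment m X C) (chi X D)\<bar>}" for D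
  have bad: "finite (bad D)" if D: "finite D" "D \<subseteq> X" "card D \<le> k" for D
  proof -
    have D': "D \<in> subsets_upto ?n X"
      using D by (auto simp: subsets_upto_def)
    have "finite {x \<in> X - D. d < \<bar>T (containment m X C) (chi X (insert x D)) - T (containment m X C) (chi X D)\<bar>}"
      if C: "C \<in> subsets_upto m D" for C
    proof -
      have "T (containment m X C) \<in> cont_fun (sigma_top ?n X)"
        using T containment_cont_fun[of C X m] C D
        by (auto simp: bounded_linear_op_def subsets_upto_def)
      then have "continuous_map (sigma_top ?n X) euclideanreal (T (containment m X C))"
        by (simp add: cont_fun_def)
      then obtain F where F: "finite F" "\<And>A'. A' \<in> subsets_upto ?n X \<Longrightarrow> A' \<inter> F = D \<inter> F \<Longrightarrow>
          \<bar>T (containment m X C) (chi X A') - T (containment m X C) (chi X D)\<bar> < d"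
        using D' \<open>0 < d\<close> unfolding continuous_map_sigma_top_iff by meson
      have "{x \<in> X - D. d < \<bar>T (containment m X C) (chi X (insert x D)) -
          T (containment m X C) (chi X D)\<bar>} \<subseteq> F"
      proof
        fix x
        assume x: "x \<in> {x \<in> X - D. d < \<bar>T (containment m X C) (chi X (insert x D)) -
          T (containment m X C) (chi X D)\<bar>}"
        have "insert x D \<in> subsets_upto ?n X"
          using D x by (auto simp: subsets_upto_def)
        then show "x \<in> F"
          using x F(2)[of "insert x D"] by (cases "x \<in> F") auto
      qed
      then show ?thesis
        using F(1) finite_subset by blast
    qed
    then have "finite (\<Union>C\<in>subsets_upto m D. {x \<in> X - D.
        d < \<bar>T (containment m X C) (chi X (insert x D)) - T (containment m X C) (chi X D)\<bar>})"
      using finite_subsets_upto[OF D(1)] by blast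
    then show ?thesis
      by (rule rev_finite_subset) (auto simp: bad_def)
  qed
  define F where "F E = (\<Union>D\<in>{D \<in> Pow E. card D \<le> k}. bad D)" for E
  have "finite (F E)" if "finite E" "E \<subseteq> X" for E
    unfolding F_def using that by (intro finite_UN_I bad) (auto intro: finite_subset)
  then obtain A where A: "A \<subseteq> X" "finite A" "card A = Suc k" "\<And>x. x \<in> A \<Longrightarrow> x \<notin> F (A - {x})"
    using Kuratowski_free_set[OF assms(2,3), of F] by blast
  show thesis
  proof (rule that[OF A(1-3)])
    fix D x C
    assume x: "x \<in> A" and D: "D \<subseteq> A - {x}" and C: "C \<in> subsets_upto m D"
    have "card D \<le> card (A - {x})"
      using D A(2) by (intro card_mono) auto
    then have "bad D \<subseteq> F (A - {x})"
      using D x A(2,3) by (auto simp: F_def)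
    then have "x \<notin> bad D"
      using A(4)[OF x] by blast
    moreover have "x \<in> X - D"
      using x D A(1) by blast
    ultimately have
      "\<not> d < \<bar>T (containment m X C) (chi X (insert x D)) - T (containment m X C) (chi X D)\<bar>"
      using C unfolding bad_def by blast
    then show "\<bar>T (containment m X C) (chi X (insert x D)) - T (containment m X C) (chi X D)\<bar> \<le> d"
      by simp
  qed
qed

text \<open>The test function \<open>g\<close> takes the value \<open>(-1) ^ (m + card (S \<inter> A))\<close> at \<open>S\<close>, for a generic \<open>A\<close>. Its
  signs on the subsets of \<open>A\<close> are those of the coefficients of the canonical extension at \<open>A\<close>.\<close>

lemma extension_operator_norm_ge:
  fixes X K :: "'a set"
  assumes T: "extension_operator (sigma_set m X) (sigma_top n X) T" and "m < n"
    and K: "has_aleph (n - 1) K" "|K| \<le>o |X|"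
  shows "of_nat (ext_const m n) \<le> op_norm (sigma_top m X) (sigma_top n X) T"
proof (rule ennreal_le_epsilon)
  fix e :: real assume "0 < e"
  obtain k where n: "n = Suc k"
    using \<open>m < n\<close> by (cases n) auto
  \<comment> \<open>The error of \<open>T g\<close> at \<open>A\<close> has at most \<open>2 ^ n\<close> terms, each at most \<open>2 ^ n * (n * d)\<close>.\<close>
  define d where "d = e / (real n * 4 ^ n)"
  have "0 < d"
    using \<open>0 < e\<close> n by (simp add: d_def)
  have bl: "bounded_linear_op (sigma_top m X) (sigma_top n X) T"
    using T \<open>m < n\<close> by (simp add: extension_operator_def subtopology_sigma_top)
  obtain A where A: "A \<subseteq> X" "finite A" "card A = n"
    and step: "\<And>D x C. x \<in> A \<Longrightarrow> D \<subseteq> A - {x} \<Longrightarrow> C \<in> subsets_upto m D \<Longrightarrow>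
      \<bar>T (containment m X C) (chi X (insert x D)) - T (containment m X C) (chi X D)\<bar> \<le> d"
    using generic_set_exists[of m X k T K d] bl K \<open>0 < d\<close> unfolding n by (metis diff_Suc_1)
  define c where "c C = (- 1 :: real) ^ m * (- 2) ^ card C" for C :: "'a set"
  define g where "g = (\<lambda>a\<in>topspace (sigma_top m X). \<Sum>C\<in>subsets_upto m A. c C * containment m X C a)"
  have "containment m X C \<in> cont_fun (sigma_top m X)" if "C \<in> subsets_upto m A" for C
    using that A by (intro containment_cont_fun) (auto simp: subsets_upto_def)
  from bounded_linear_op_sum[OF bl finite_subsets_upto[OF A(2)] this, where c = c]
  have g: "g \<in> cont_fun (sigma_top m X)"
    and Tg: "y \<in> topspace (sigma_top n X) \<Longrightarrow>
      T g y = (\<Sum>C\<in>subsets_upto m A. c C * T (containment m X C) y)" for y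
    unfolding g_def by auto
  have "\<bar>g (chi X S)\<bar> \<le> 1" if "S \<in> subsets_upto m X" for S
    using that sum_neg2_containment[OF A(1,2) that]
    by (simp add: g_def c_def topspace_sigma_top power_abs)
  then have "sup_norm (sigma_top m X) g \<le> 1"
    using sup_norm_le_iff[of 1 "sigma_top m X" g] by (auto simp: topspace_sigma_top)
  then have norm: "sup_norm (sigma_top n X) (T g) \<le> op_norm (sigma_top m X) (sigma_top n X) T"
    unfolding op_norm_def using g by (intro SUP_upper) auto
  have AX: "chi X A \<in> topspace (sigma_top n X)"
    using A by (auto simp: topspace_sigma_top subsets_upto_def)
  have "real (ext_const m n) - T g (chi X A) =
      (\<Sum>C\<in>subsets_upto m A. c C * (1 - T (containment m X C) (chi X A)))"
    using ext_const_eq_sum_neg2[OF A(2), of m] A(3) \<open>m < n\<close> unfolding Tg[OF AX]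
    by (simp add: c_def right_diff_distrib sum_subtractf)
  also have "\<dots> \<le> (\<Sum>C\<in>subsets_upto m A. 2 ^ n * (real n * d))"
  proof (rule sum_mono)
    fix C assume C: "C \<in> subsets_upto m A"
    have "\<bar>T (containment m X C) (chi X A) - 1\<bar> \<le> real (card A) * d"
      using \<open>m < n\<close> \<open>0 < d\<close> A C by (intro extension_value_near_1[OF T _ A(1,2) step C]) auto
    moreover have "\<bar>c C\<bar> \<le> 2 ^ n"
      using C \<open>m < n\<close> by (auto simp: c_def abs_mult power_abs subsets_upto_def intro!: power_increasing)
    ultimately have "\<bar>c C * (1 - T (containment m X C) (chi X A))\<bar> \<le> 2 ^ n * (real n * d)"
      unfolding abs_mult using A(3) by (intro mult_mono) auto
    then show "c C * (1 - T (containment m X C) (chi X A)) \<le> 2 ^ n * (real n * d)"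
      by linarith
  qed
  also have "\<dots> = real (card (subsets_upto m A)) * (2 ^ n * (real n * d))"
    by simp
  also have "\<dots> \<le> 2 ^ n * (2 ^ n * (real n * d))"
  proof (rule mult_right_mono)
    have "card (subsets_upto m A) \<le> card (Pow A)"
      using A(2) by (intro card_mono) (auto simp: subsets_upto_def)
    then show "real (card (subsets_upto m A)) \<le> 2 ^ n"
      using A by (metis card_Pow of_nat_le_iff of_nat_numeral of_nat_power)
  qed (use \<open>0 < d\<close> in simp)
  also have "\<dots> = e"
  proof -
    have "(2 :: real) ^ n * 2 ^ n = 4 ^ n"
      by (simp flip: power_mult_distrib)
    then have "2 ^ n * (2 ^ n * (real n * d)) = 4 ^ n * (real n * d)"
      by (metis mult.assoc)
    moreover have "real n \<noteq> 0"
      using n by simp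
    ultimately show ?thesis
      by (simp add: d_def)
  qed
  finally have "real (ext_const m n) \<le> \<bar>T g (chi X A)\<bar> + e"
    by linarith
  then have "of_nat (ext_const m n) \<le> ennreal \<bar>T g (chi X A)\<bar> + ennreal e"
    using \<open>0 < e\<close> by (simp add: ennreal_of_nat_eq_real_of_nat flip: ennreal_plus)
  also have "ennreal \<bar>T g (chi X A)\<bar> \<le> sup_norm (sigma_top n X) (T g)"
    unfolding sup_norm_def using AX by (rule SUP_upper)
  also note norm
  finally show "of_nat (ext_const m n) \<le> op_norm (sigma_top m X) (sigma_top n X) T + ennreal e"
    by simp
qed

theorem corollary3p8:
  fixes m n :: nat and X :: "'a set"
  assumes "m < n"
    and "\<exists>A :: 'a set. has_aleph (n - 1) A \<and> |A| \<le>o |X|"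
  shows "eta (sigma_set m X) (sigma_top n X) =
           op_norm (sigma_top m X) (sigma_top n X) (canonical_ext m n X) \<and>
         op_norm (sigma_top m X) (sigma_top n X) (canonical_ext m n X) =
           of_nat (\<Sum>k=0..m. (n choose k) * ((n - k - 1) choose (m - k)))"
proof -
  let ?N = "of_nat (ext_const m n) :: ennreal"
  let ?c = "op_norm (sigma_top m X) (sigma_top n X) (canonical_ext m n X)"
  obtain K :: "'a set" where K: "has_aleph (n - 1) K" "|K| \<le>o |X|"
    using assms(2) by blast
  have sub: "subtopology (sigma_top n X) (sigma_set m X) = sigma_top m X"
    using assms(1) by (simp add: subtopology_sigma_top)
  have T: "extension_operator (sigma_set m X) (sigma_top n X) (canonical_ext m n X)"
    by (rule canonical_ext_extension_operator[OF assms(1)])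
  have "?c = ?N"
    using canonical_ext_op_norm_le[OF assms(1)] extension_operator_norm_ge[OF T assms(1) K]
    by (rule antisym)
  moreover have "eta (sigma_set m X) (sigma_top n X) \<le> ?c"
    unfolding eta_def sub using T by (intro INF_lower) simp
  moreover have "?N \<le> eta (sigma_set m X) (sigma_top n X)"
    unfolding eta_def sub
    using extension_operator_norm_ge[OF _ assms(1) K] by (intro INF_greatest) simp
  ultimately show ?thesis
    by (simp add: ext_const_def)
qed

end
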